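(* Let $G$ be a connected digraph, $k \ge 3$ an integer and $X \subseteq V(G)$ such that: (i) $d(u) \le 2(k-1)$ for every $u \in X$; (ii) for every connected component $S$ of $G[X]$, $\vec{\chi}(G-S) \le k-1$; (iii) the number of connected components of $G-X$ is strictly greater than the number of connected components of $G[X]$. Then $\vec{\chi}(G) \le k-1$.
   Context: Digraphs are finite, without loops and parallel arcs (digons allowed). $d(u)=d^+(u)+d^-(u)$. A dicolouring colours vertices so that each colour class induces an acyclic subdigraph; $\vec{\chi}$ is the minimum number of colours. Connectivity is weak connectivity; a connected component is a maximal vertex set inducing a connected subdigraph. Convention: the empty set is considered connected, so the empty digraph has exactly one connected component (the empty set). *)

theory Defs
  imports "Graph_Theory.Digraph_Component"
begin

text \<open>
  The constant \<^const>\<open>connected\<close> is weak connectivity, but it is false for the empty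
  digraph; here the empty vertex set counts as connected.
\<close>
definition weakly_connected :: "('a, 'b) pre_digraph \<Rightarrow> bool" where
  "weakly_connected G \<longleftrightarrow> verts G = {} \<or> connected G"

text \<open>
  By the convention above the empty digraph has exactly one component, the empty set;
  in a nonempty digraph the maximality condition excludes the empty set.
\<close>
definition components :: "('a, 'b) pre_digraph \<Rightarrow> 'a set set" where
  "components G = {S. S \<subseteq> verts G \<and> weakly_connected (G \<restriction> S) \<and>
     (\<forall>T. S \<subseteq> T \<and> T \<subseteq> verts G \<and> weakly_connected (G \<restriction> T) \<longrightarrow> T = S)}"

text \<open>
  Cycles in the sense of \<^const>\<open>pre_digraph.cycle\<close> are directed, and a digon is a
  cycle of length two.
\<close>
definition acyclic_digraph :: "('a, 'b) pre_digraph \<Rightarrow> bool" where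
  "acyclic_digraph G \<longleftrightarrow> \<not> (\<exists>p. pre_digraph.cycle G p)"

definition dicolouring :: "('a, 'b) pre_digraph \<Rightarrow> nat \<Rightarrow> ('a \<Rightarrow> nat) \<Rightarrow> bool" where
  "dicolouring G n c \<longleftrightarrow> (\<forall>v \<in> verts G. c v < n) \<and>
     (\<forall>i < n. acyclic_digraph (G \<restriction> {v \<in> verts G. c v = i}))"

text \<open>
  A finite loopless digraph has a dicolouring (give all vertices distinct colours), so
  the minimum below exists for every such digraph.
\<close>
definition dichromatic_number :: "('a, 'b) pre_digraph \<Rightarrow> nat" where
  "dichromatic_number G = (LEAST n. \<exists>c. dicolouring G n c)"

definition total_degree :: "('a, 'b) pre_digraph \<Rightarrow> 'a \<Rightarrow> nat" where
  "total_degree G u = out_degree G u + in_degree G u"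

abbreviation delete_verts :: "('a, 'b) pre_digraph \<Rightarrow> 'a set \<Rightarrow> ('a, 'b) pre_digraph" where
  "delete_verts G S \<equiv> G \<restriction> (verts G - S)"

end

theory Submission
  imports Defs "HOL-Combinatorics.Transposition"
begin

text \<open>
  Let \<open>n = k - 1\<close>. A vertex with fewer than \<open>2 * n\<close> coloured arcs can be coloured greedily: some
  colour is missing among its in-neighbours or among its out-neighbours, so no monochromatic cycle
  arises. Hence each component \<open>S\<close> of \<open>G[X]\<close> can be coloured up to one last
  vertex \<open>v\<close> of our choice.

  The colours of each component of \<open>G - X\<close> (a cluster) may be permuted independently. Passing to a
  minimal subfamily of the components of \<open>G[X]\<close> that satisfies (iii), every nonempty set \<open>A\<close>
  of them is adjacent to more than \<open>|A|\<close> clusters. This surplus suffices to treat the components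
  one at a time: for each, join two clusters adjacent to one of its vertices \<open>v\<close> by giving a
  neighbour of \<open>v\<close> in the one the colour of a neighbour in the other. The joins form a forest on
  the clusters. If \<open>v\<close> is stuck at the end, it takes the common colour; a monochromatic cycle then
  runs through clusters only along edges of this forest, which is impossible.
\<close>

section \<open>Connectivity\<close>

definition adjacent :: "('a \<times> 'a) set \<Rightarrow> 'a \<Rightarrow> 'a \<Rightarrow> bool" where
  "adjacent E u v \<longleftrightarrow> (u, v) \<in> E \<or> (v, u) \<in> E"

text \<open>Phrased by cuts instead of walks, which suits adding and removing single vertices. It
  holds for the empty set, in agreement with \<open>weakly_connected\<close>.\<close>

definition cut_connected :: "('a \<times> 'a) set \<Rightarrow> 'a set \<Rightarrow> bool" where
  "cut_connected E S \<longleftrightarrow>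
     (\<forall>A. A \<subseteq> S \<and> A \<noteq> {} \<and> A \<noteq> S \<longrightarrow> (\<exists>a\<in>A. \<exists>b\<in>S - A. adjacent E a b))"

text \<open>Unlike \<^const>\<open>components\<close>, this is empty for \<open>Y = {}\<close>.\<close>

definition conn_parts :: "('a \<times> 'a) set \<Rightarrow> 'a set \<Rightarrow> 'a set set" where
  "conn_parts E Y = {H. H \<subseteq> Y \<and> H \<noteq> {} \<and> cut_connected E H \<and>
     (\<forall>a\<in>H. \<forall>b\<in>Y - H. \<not> adjacent E a b)}"

lemma adjacent_sym: "adjacent E u v \<Longrightarrow> adjacent E v u"
  by (auto simp: adjacent_def)

lemma cut_connected_singleton: "cut_connected E {v}"
  by (auto simp: cut_connected_def)

lemma cut_connected_insert:
  assumes "cut_connected E P" "p \<in> P" "adjacent E p u"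
  shows "cut_connected E (insert u P)"
  unfolding cut_connected_def
proof (intro allI impI)
  fix A assume A: "A \<subseteq> insert u P \<and> A \<noteq> {} \<and> A \<noteq> insert u P"
  show "\<exists>a\<in>A. \<exists>b\<in>insert u P - A. adjacent E a b"
  proof (cases "A \<inter> P \<noteq> {} \<and> A \<inter> P \<noteq> P")
    case True
    then obtain a b where "a \<in> A \<inter> P" "b \<in> P - A \<inter> P" "adjacent E a b"
      using assms(1) unfolding cut_connected_def by (metis inf_le2)
    then show ?thesis by blast
  next
    case False
    then consider "A \<inter> P = {}" | "P \<subseteq> A" by blast
    then show ?thesis
    proof cases
      case 1
      then show ?thesis using A assms(2,3) adjacent_sym by fastforce
    next
      case 2
      then show ?thesis using A assms(2,3) by blast
    qed
  qed
qed

text \<open>A maximal connected proper subset \<open>P\<close> containing \<open>v\<close> has a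
  neighbour \<open>u\<close> in \<open>Q - P\<close>, and by maximality \<open>insert u P\<close> is
  all of \<open>Q\<close>. The neighbour \<open>s\<close> is supplied because greedy colouring of
  \<open>u\<close> needs an uncoloured neighbour.\<close>

lemma cut_connected_remove_vertex:
  assumes fin: "finite Q" and conn: "cut_connected E Q" and v: "v \<in> Q" "Q \<noteq> {v}"
  obtains u s where "u \<in> Q" "u \<noteq> v" "cut_connected E (Q - {u})" "s \<in> Q - {u}" "adjacent E u s"
proof -
  let ?F = "{P. P \<subset> Q \<and> v \<in> P \<and> cut_connected E P}"
  have "finite ?F" using fin by (auto intro: finite_subset[of _ "Pow Q"])
  moreover have "{v} \<in> ?F" using v cut_connected_singleton[of E v] by blast
  ultimately have "\<exists>P\<in>?F. \<forall>P'\<in>?F. P \<subseteq> P' \<longrightarrow> P = P'"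
    by (intro finite_has_maximal) auto
  then obtain P where P: "P \<in> ?F" and max: "\<forall>P'\<in>?F. P \<subseteq> P' \<longrightarrow> P = P'"
    by (rule bexE)
  have "P \<subseteq> Q" "P \<noteq> {}" "P \<noteq> Q" using P by auto
  then obtain s u where su: "s \<in> P" "u \<in> Q - P" "adjacent E s u"
    using conn unfolding cut_connected_def by meson
  have "cut_connected E (insert u P)" using cut_connected_insert su P by fast
  then have "insert u P \<notin> ?F" using bspec[OF max, of "insert u P"] su by blast
  then have "insert u P = Q" using P su \<open>cut_connected E (insert u P)\<close> by blast
  then have "Q - {u} = P" using su by blast
  then show thesis using that[of u s] P su adjacent_sym[of E s u] by auto
qed

lemma conn_parts_inter:
  assumes "H \<in> conn_parts E Y" "H' \<in> conn_parts E Y" "z \<in> H" "z \<in> H'"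
  shows "H = H'"
proof -
  have "H \<subseteq> H'" if H: "H \<in> conn_parts E Y" "H' \<in> conn_parts E Y" "z \<in> H" "z \<in> H'" for H H'
  proof (rule ccontr)
    assume "\<not> H \<subseteq> H'"
    then have "H \<inter> H' \<subseteq> H" "H \<inter> H' \<noteq> {}" "H \<inter> H' \<noteq> H" using H by blast+
    moreover have "cut_connected E H" using H unfolding conn_parts_def by blast
    ultimately obtain a b where "a \<in> H \<inter> H'" "b \<in> H - H \<inter> H'" "adjacent E a b"
      unfolding cut_connected_def by metis
    moreover have "H \<subseteq> Y" using H unfolding conn_parts_def by blast
    ultimately show False using H(2) unfolding conn_parts_def by blast
  qed
  then show ?thesis using assms by blast
qed

lemma conn_parts_cover:
  assumes "finite Y" "y \<in> Y"
  obtains H where "H \<in> conn_parts E Y" "y \<in> H"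
proof -
  let ?F = "{P. P \<subseteq> Y \<and> y \<in> P \<and> cut_connected E P}"
  have "finite ?F" using assms by (auto intro: finite_subset[of _ "Pow Y"])
  moreover have "{y} \<in> ?F" using assms cut_connected_singleton[of E y] by blast
  ultimately have "\<exists>P\<in>?F. \<forall>P'\<in>?F. P \<subseteq> P' \<longrightarrow> P = P'"
    by (intro finite_has_maximal) auto
  then obtain P where P: "P \<in> ?F" and max: "\<forall>P'\<in>?F. P \<subseteq> P' \<longrightarrow> P = P'"
    by (rule bexE)
  have "\<not> adjacent E a b" if "a \<in> P" "b \<in> Y - P" for a b
  proof
    assume "adjacent E a b"
    then have "insert b P \<in> ?F" using that P cut_connected_insert by fast
    then show False using bspec[OF max, of "insert b P"] that by blast
  qed
  then have "P \<in> conn_parts E Y" using P unfolding conn_parts_def by blast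
  then show thesis using that P by blast
qed

lemma finite_conn_parts: "finite Y \<Longrightarrow> finite (conn_parts E Y)"
  by (rule finite_subset[of _ "Pow Y"]) (auto simp: conn_parts_def)

lemma conn_parts_mono:
  assumes "H \<in> conn_parts E Y" "Y \<subseteq> Y'" "\<And>a b. a \<in> H \<Longrightarrow> b \<in> Y' - Y \<Longrightarrow> \<not> adjacent E a b"
  shows "H \<in> conn_parts E Y'"
proof -
  have "\<not> adjacent E a b" if "a \<in> H" "b \<in> Y' - H" for a b
    using assms(1) assms(3)[OF that(1), of b] that unfolding conn_parts_def by (cases "b \<in> Y") auto
  then show ?thesis using assms(1,2) unfolding conn_parts_def by auto
qed

section \<open>Families with surplus\<close>

text \<open>
  Choosing \<open>i\<close> in a minimal tight set, where the surplus is exactly one, any two elements of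
  \<open>N i\<close> may be identified without destroying the surplus of the remaining indices: a tight set
  avoiding \<open>i\<close> and containing both elements would contradict minimality or submodularity.
\<close>

lemma surplus_choice:
  fixes N :: "'i \<Rightarrow> 'c set"
  assumes fin: "finite I" "\<And>i. i \<in> I \<Longrightarrow> finite (N i)" and ne: "I \<noteq> {}"
    and surplus: "\<And>A. A \<subseteq> I \<Longrightarrow> A \<noteq> {} \<Longrightarrow> card A < card (\<Union> (N ` A))"
  obtains i where "i \<in> I"
    "\<And>A C D. A \<subseteq> I - {i} \<Longrightarrow> A \<noteq> {} \<Longrightarrow> C \<in> N i \<Longrightarrow> D \<in> N i \<Longrightarrow> C \<noteq> D \<Longrightarrow>
       C \<in> \<Union> (N ` A) \<Longrightarrow> D \<in> \<Union> (N ` A) \<Longrightarrow> Suc (card A) < card (\<Union> (N ` A))"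
proof -
  define tight where
    "tight A \<longleftrightarrow> A \<subseteq> I \<and> A \<noteq> {} \<and> card (\<Union> (N ` A)) = Suc (card A)" for A
  have finA: "finite A" "finite (\<Union> (N ` A))" if "A \<subseteq> I" for A
    using that fin finite_subset[of A I] by auto
  show thesis
  proof (cases "\<exists>A. tight A")
    case False
    obtain i where "i \<in> I" using ne by blast
    moreover have "Suc (card A) < card (\<Union> (N ` A))" if "A \<subseteq> I" "A \<noteq> {}" for A
      using False surplus[OF that] that unfolding tight_def by (metis Suc_lessI)
    ultimately show thesis by (intro that[of i]) auto
  next
    case True
    obtain B where B: "tight B" and min: "\<And>A. tight A \<Longrightarrow> card B \<le> card A"
      using True ex_has_least_nat[of tight _ card] by blast
    then obtain i where i: "i \<in> B" unfolding tight_def by blast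
    have BI: "B \<subseteq> I" "card (\<Union> (N ` B)) = Suc (card B)" using B unfolding tight_def by auto
    show thesis
    proof (rule that[of i])
      show "i \<in> I" using i BI by blast
      fix A C D
      assume A: "A \<subseteq> I - {i}" "A \<noteq> {}" and CD: "C \<in> N i" "D \<in> N i" "C \<noteq> D"
        "C \<in> \<Union> (N ` A)" "D \<in> \<Union> (N ` A)"
      have AI: "A \<subseteq> I" using A by blast
      note fins = finA[OF AI] finA[OF BI(1)]
      show "Suc (card A) < card (\<Union> (N ` A))"
      proof (rule ccontr)
        assume "\<not> ?thesis"
        then have cA: "card (\<Union> (N ` A)) = Suc (card A)" using surplus[OF AI A(2)] by simp
        have u: "card (\<Union> (N ` (A \<union> B))) > card (A \<union> B)"
          using surplus[of "A \<union> B"] AI BI A by auto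
        have e: "card (\<Union> (N ` A)) + card (\<Union> (N ` B)) =
            card (\<Union> (N ` (A \<union> B))) + card (\<Union> (N ` A) \<inter> \<Union> (N ` B))"
          using card_Un_Int[OF fins(2) fins(4)] by (simp add: image_Un)
        have e': "card A + card B = card (A \<union> B) + card (A \<inter> B)"
          by (rule card_Un_Int[OF fins(1,3)])
        \<comment> \<open>\<open>u\<close>, \<open>e\<close> and \<open>e'\<close> bound the number
          of common neighbours of \<open>A\<close> and \<open>B\<close> by
          \<open>card (A \<inter> B) + 1\<close>. If \<open>A\<close> and \<open>B\<close> are
          disjoint, \<open>C\<close> and \<open>D\<close> exceed this bound; otherwise
          \<open>A \<inter> B\<close> is tight and, missing \<open>i\<close>, smaller than
          \<open>B\<close>.\<close>
        show False
        proof (cases "A \<inter> B = {}")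
          case True
          have "{C, D} \<subseteq> \<Union> (N ` A) \<inter> \<Union> (N ` B)" using CD i by blast
          then have "2 \<le> card (\<Union> (N ` A) \<inter> \<Union> (N ` B))"
            using card_mono[of "\<Union> (N ` A) \<inter> \<Union> (N ` B)" "{C, D}"] fins CD(3) by auto
          then show False using u e e' cA BI True by simp
        next
          case False
          have "card (\<Union> (N ` (A \<inter> B))) \<le> card (\<Union> (N ` A) \<inter> \<Union> (N ` B))"
            by (rule card_mono) (use fins in auto)
          moreover have "card (A \<inter> B) < card (\<Union> (N ` (A \<inter> B)))"
            by (rule surplus) (use AI False in auto)
          ultimately have "tight (A \<inter> B)" using u e e' cA BI False AI unfolding tight_def by auto
          then have "card B \<le> card (A \<inter> B)" by (rule min)
          moreover have "A \<inter> B \<subset> B" using A i by blast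
          ultimately show False using psubset_card_mono[OF fins(3), of "A \<inter> B"] by simp
        qed
      qed
    qed
  qed
qed

section \<open>Rank functions and greedy colouring\<close>

text \<open>
  A rank function witnesses that the monochromatic arcs outside \<open>T\<close> close no cycle even after
  every \<open>T\<close>-class has been contracted to a point. This is the form in which acyclicity survives
  independent colour permutations on the classes.
\<close>

definition ranked :: "('a \<times> 'a) set \<Rightarrow> ('a \<times> 'a) set \<Rightarrow> 'a set \<Rightarrow> ('a \<Rightarrow> nat) \<Rightarrow> ('a \<Rightarrow> int) \<Rightarrow> bool" where
  "ranked E T U \<psi> h \<longleftrightarrow>
     (\<forall>a\<in>U. \<forall>b\<in>U. (a, b) \<in> E \<longrightarrow> \<psi> a = \<psi> b \<longrightarrow> (a, b) \<notin> T \<longrightarrow> h a < h b)"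

text \<open>Doubling leaves an odd integer free just above \<open>2 * Max A\<close> or, if
  \<open>A\<close> is empty, just below \<open>2 * Min B\<close>. It becomes the rank of a newly
  coloured vertex.\<close>

lemma int_separate:
  fixes A B :: "int set"
  assumes "finite A" "finite B" "\<And>a b. a \<in> A \<Longrightarrow> b \<in> B \<Longrightarrow> a < b"
  shows "\<exists>r. (\<forall>a\<in>A. 2 * a < r) \<and> (\<forall>b\<in>B. r < 2 * b)"
proof (cases "A = {}")
  case True
  show ?thesis
  proof (cases "B = {}")
    case False
    have "2 * Min B - 1 < 2 * b" if "b \<in> B" for b using Min_le[OF assms(2) that] by simp
    then show ?thesis using True by blast
  qed (use True in simp)
next
  case False
  have "2 * a < 2 * Max A + 1" if "a \<in> A" for a using Max_ge[OF assms(1) that] by simp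
  moreover have "2 * Max A + 1 < 2 * b" if "b \<in> B" for b
    using assms(3)[OF Max_in[OF assms(1) False] that] by simp
  ultimately show ?thesis by blast
qed

text \<open>The rank of \<open>s\<close> must lie above its in-neighbours and below its
  out-neighbours of colour \<open>c\<close>. The last hypothesis separates these ranks, and doubling
  \<open>h\<close> makes room for \<open>r\<close> without changing the order.\<close>

lemma ranked_insert:
  assumes "ranked E T U \<psi> h" "finite U" "s \<notin> U" "(s, s) \<notin> E"
    and "\<And>a b. a \<in> U \<Longrightarrow> b \<in> U \<Longrightarrow> (a, s) \<in> E \<Longrightarrow> (s, b) \<in> E \<Longrightarrow> \<psi> a = c \<Longrightarrow> \<psi> b = c \<Longrightarrow> h a < h b"
  obtains r where "ranked E T (insert s U) (\<psi>(s := c)) ((\<lambda>w. 2 * h w)(s := r))"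
proof -
  let ?A = "{a \<in> U. (a, s) \<in> E \<and> \<psi> a = c}" and ?B = "{b \<in> U. (s, b) \<in> E \<and> \<psi> b = c}"
  have lt: "x < y" if "x \<in> h ` ?A" "y \<in> h ` ?B" for x y using that assms(5) by blast
  have fin: "finite (h ` ?A)" "finite (h ` ?B)" using assms(2) by auto
  obtain r where "\<forall>x\<in>h ` ?A. 2 * x < r" "\<forall>y\<in>h ` ?B. r < 2 * y"
    using int_separate[OF fin lt] by auto
  then show thesis using assms(1,3,4) by (intro that[of r]) (auto simp: ranked_def)
qed

lemma free_colour:
  fixes \<psi> :: "'a \<Rightarrow> nat"
  assumes "finite A" "finite B" "card A + card B < 2 * n"
  shows "\<exists>c<n. c \<notin> \<psi> ` A \<or> c \<notin> \<psi> ` B"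
proof (rule ccontr)
  assume "\<not> ?thesis"
  then have "{..<n} \<subseteq> \<psi> ` A" "{..<n} \<subseteq> \<psi> ` B" by blast+
  then have "n \<le> card A" "n \<le> card B"
    by (metis assms(1,2) card_image_le card_lessThan card_mono finite_imageI le_trans)+
  then show False using assms(3) by simp
qed

text \<open>The borderline case of the pigeonhole argument: if all \<open>n\<close> colours occur on
  both sides, each side has exactly \<open>n\<close> vertices, one per colour.\<close>

lemma free_colour_or_inj:
  fixes \<psi> :: "'a \<Rightarrow> nat"
  assumes fin: "finite A" "finite B" and le: "card A + card B \<le> 2 * n"
  shows "(\<exists>c<n. c \<notin> \<psi> ` A \<or> c \<notin> \<psi> ` B) \<or> (inj_on \<psi> A \<and> inj_on \<psi> B)"
proof (rule ccontr)
  assume c: "\<not> ?thesis"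
  then have "{..<n} \<subseteq> \<psi> ` A" "{..<n} \<subseteq> \<psi> ` B" by blast+
  then have "n \<le> card (\<psi> ` A)" "n \<le> card (\<psi> ` B)"
    by (metis fin card_lessThan card_mono finite_imageI)+
  moreover have "card (\<psi> ` A) \<le> card A" "card (\<psi> ` B) \<le> card B"
    using fin by (simp_all add: card_image_le)
  ultimately have "card (\<psi> ` A) = card A" "card (\<psi> ` B) = card B" using le by simp_all
  then show False using c fin by (simp add: eq_card_imp_inj_on)
qed

lemma finite_neighbours:
  assumes "finite E"
  shows "finite {a. (a, u) \<in> E}" "finite {b. (u, b) \<in> E}"
proof -
  have "{a. (a, u) \<in> E} \<subseteq> fst ` E" "{b. (u, b) \<in> E} \<subseteq> snd ` E" by force+
  then show "finite {a. (a, u) \<in> E}" "finite {b. (u, b) \<in> E}"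
    using assms finite_subset by blast+
qed

text \<open>The neighbour \<open>s\<close> outside \<open>U\<close> takes at least one arc out of
  the count, so \<open>free_colour\<close> applies to the neighbours in \<open>U\<close>.\<close>

lemma uncoloured_neighbour_free_colour:
  fixes \<psi> :: "'a \<Rightarrow> nat"
  assumes "finite E" "card {a. (a, u) \<in> E} + card {b. (u, b) \<in> E} \<le> 2 * n"
    and "adjacent E u s" "s \<notin> U"
  obtains c where "c < n"
    "(\<forall>a\<in>U. (a, u) \<in> E \<longrightarrow> \<psi> a \<noteq> c) \<or> (\<forall>b\<in>U. (u, b) \<in> E \<longrightarrow> \<psi> b \<noteq> c)"
proof -
  let ?A = "{a. (a, u) \<in> E}" and ?B = "{b. (u, b) \<in> E}"
  have fin: "finite ?A" "finite ?B"
    using assms(1) by (rule finite_neighbours)+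
  then have le: "card (?A \<inter> U) \<le> card ?A" "card (?B \<inter> U) \<le> card ?B" by (auto intro: card_mono)
  have "s \<in> ?A - U \<or> s \<in> ?B - U" using assms(3,4) by (auto simp: adjacent_def)
  then have "?A \<inter> U \<subset> ?A \<or> ?B \<inter> U \<subset> ?B" by blast
  then have "card (?A \<inter> U) < card ?A \<or> card (?B \<inter> U) < card ?B"
    using fin psubset_card_mono by blast
  then have "card (?A \<inter> U) + card (?B \<inter> U) < 2 * n" using le assms(2) by linarith
  then obtain c where "c < n" "c \<notin> \<psi> ` (?A \<inter> U) \<or> c \<notin> \<psi> ` (?B \<inter> U)"
    using free_colour[of "?A \<inter> U" "?B \<inter> U" n \<psi>] fin by auto
  then have "(\<forall>a\<in>U. (a, u) \<in> E \<longrightarrow> \<psi> a \<noteq> c) \<or> (\<forall>b\<in>U. (u, b) \<in> E \<longrightarrow> \<psi> b \<noteq> c)"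
    by (auto simp: image_iff Ball_def)
  with \<open>c < n\<close> show thesis by (rule that)
qed

text \<open>
  Every vertex coloured here still has an uncoloured neighbour, so at most \<open>2 * n - 1\<close> coloured
  arcs and some colour missing on the in-side or on the out-side.
\<close>

lemma greedy_extension:
  assumes "finite E" "\<And>u. (u, u) \<notin> E"
    and "finite Q" "cut_connected E Q" "v \<in> Q"
    and "finite U" "U \<inter> Q = {}"
    and "\<And>u. u \<in> Q \<Longrightarrow> card {a. (a, u) \<in> E} + card {b. (u, b) \<in> E} \<le> 2 * n"
    and "ranked E T U \<psi> h" "\<psi> ` U \<subseteq> {..<n}"
  shows "\<exists>\<psi>' h' m. ranked E T (U \<union> (Q - {v})) \<psi>' h' \<and> \<psi>' ` (U \<union> (Q - {v})) \<subseteq> {..<n} \<and>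
    (\<forall>u\<in>U. \<psi>' u = \<psi> u \<and> h' u = m * h u) \<and> m > 0"
  using assms(3-)
proof (induction "card Q" arbitrary: Q U \<psi> h rule: less_induct)
  case less
  show ?case
  proof (cases "Q = {v}")
    case True
    then show ?thesis using less.prems by (intro exI[of _ \<psi>] exI[of _ h] exI[of _ 1]) auto
  next
    case False
    obtain u s where u: "u \<in> Q" "u \<noteq> v" "cut_connected E (Q - {u})" "s \<in> Q - {u}" "adjacent E u s"
      by (rule cut_connected_remove_vertex[OF less.prems(1-3) False])
    have uU: "u \<notin> U" "s \<notin> U" using u less.prems(5) by auto
    obtain c where c: "c < n"
      "(\<forall>a\<in>U. (a, u) \<in> E \<longrightarrow> \<psi> a \<noteq> c) \<or> (\<forall>b\<in>U. (u, b) \<in> E \<longrightarrow> \<psi> b \<noteq> c)"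
      by (rule uncoloured_neighbour_free_colour[OF assms(1) less.prems(6)[OF u(1)] u(5) uU(2)])
    \<comment> \<open>Since \<open>c\<close> is missing on one side of \<open>u\<close>, the
      separation condition is vacuous.\<close>
    obtain r where r: "ranked E T (insert u U) (\<psi>(u := c)) ((\<lambda>w. 2 * h w)(u := r))"
      by (rule ranked_insert[OF less.prems(7,4) uU(1) assms(2), of c]) (use c(2) in auto)
    have "card (Q - {u}) < card Q" using less.prems(1) u(1) by (meson card_Diff1_less)
    then have "\<exists>\<psi>' h' m. ranked E T (insert u U \<union> (Q - {u} - {v})) \<psi>' h' \<and>
      \<psi>' ` (insert u U \<union> (Q - {u} - {v})) \<subseteq> {..<n} \<and>
      (\<forall>w\<in>insert u U. \<psi>' w = (\<psi>(u := c)) w \<and> h' w = m * ((\<lambda>w. 2 * h w)(u := r)) w) \<and> m > 0"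
    proof (rule less.hyps)
      show "ranked E T (insert u U) (\<psi>(u := c)) ((\<lambda>w. 2 * h w)(u := r))" by (rule r)
    qed (use less.prems u c in auto)
    then obtain \<psi>' h' m where *: "ranked E T (insert u U \<union> (Q - {u} - {v})) \<psi>' h'"
      "\<psi>' ` (insert u U \<union> (Q - {u} - {v})) \<subseteq> {..<n}" "m > 0"
      "\<And>w. w \<in> insert u U \<Longrightarrow> \<psi>' w = (\<psi>(u := c)) w \<and> h' w = m * ((\<lambda>w. 2 * h w)(u := r)) w"
      by blast
    have eq: "insert u U \<union> (Q - {u} - {v}) = U \<union> (Q - {v})" using u by blast
    \<comment> \<open>Inserting \<open>u\<close> doubled the ranks on \<open>U\<close> before the
      recursion scaled them by \<open>m\<close>; a positive common factor keeps order and equality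
      of ranks.\<close>
    have "\<psi>' w = \<psi> w \<and> h' w = (2 * m) * h w" if "w \<in> U" for w
      using *(4)[of w] that uU by auto
    then show ?thesis using *(1-3) unfolding eq by (intro exI[of _ \<psi>'] exI[of _ h'] exI[of _ "2 * m"]) auto
  qed
qed

text \<open>\<open>\<kappa>\<close> names the cluster of each vertex of \<open>W\<close>. Used as
  \<open>T\<close> in \<open>ranked\<close>, this relation exempts the arcs inside a
  cluster.\<close>

definition same_cluster :: "'a set \<Rightarrow> ('a \<Rightarrow> 'c) \<Rightarrow> ('a \<times> 'a) set" where
  "same_cluster W \<kappa> = {(a, b). a \<in> W \<and> b \<in> W \<and> \<kappa> a = \<kappa> b}"

section \<open>Extending the colouring of the clusters\<close>

text \<open>
  If \<open>v\<close> is stuck, each colour occurs exactly once on its in-arcs and once on its out-arcs. Since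
  \<open>p\<close> and \<open>q\<close> share a colour, this forces \<open>p \<rightarrow> v \<rightarrow> q\<close>; giving \<open>v\<close> that colour
  opens only a passage from the cluster of \<open>p\<close> to the cluster of \<open>q\<close>, and contracting both
  clusters together was already harmless.
\<close>

lemma split_merged_cluster:
  fixes \<kappa> \<kappa>' :: "'a \<Rightarrow> 'c" and \<psi> :: "'a \<Rightarrow> nat"
  assumes E: "finite E" "\<And>u. (u, u) \<notin> E"
    and \<kappa>'_def: "\<And>w. \<kappa>' w = (if \<kappa> w = \<kappa> q then \<kappa> p else \<kappa> w)"
    and Q: "finite Q" "cut_connected E Q" "v \<in> Q" "finite U" "U \<inter> Q = {}"
    and deg: "\<And>u. u \<in> Q \<Longrightarrow> card {a. (a, u) \<in> E} + card {b. (u, b) \<in> E} \<le> 2 * n"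
    and W: "W \<subseteq> U" "\<And>a b. a \<in> W \<Longrightarrow> b \<in> W \<Longrightarrow> \<kappa> a \<noteq> \<kappa> b \<Longrightarrow> \<not> adjacent E a b"
    and ranked: "ranked E (same_cluster W \<kappa>') U \<psi> h" "\<psi> ` U \<subseteq> {..<n}"
      "\<And>a b. (a, b) \<in> same_cluster W \<kappa>' \<Longrightarrow> h a = h b"
    and pq: "p \<in> W" "q \<in> W" "\<kappa> p \<noteq> \<kappa> q" "\<psi> p = \<psi> q"
      "(p, v) \<in> E \<and> (v, q) \<in> E \<or> (p, v) \<in> E \<and> (q, v) \<in> E \<or> (v, p) \<in> E \<and> (v, q) \<in> E"
  obtains \<psi>' h' where "ranked E (same_cluster W \<kappa>) (U \<union> Q) \<psi>' h'" "\<psi>' ` (U \<union> Q) \<subseteq> {..<n}"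
    "\<And>a. a \<in> U \<Longrightarrow> \<psi>' a = \<psi> a" "\<And>a b. (a, b) \<in> same_cluster W \<kappa> \<Longrightarrow> h' a = h' b"
proof -
  let ?T = "same_cluster W \<kappa>"
  \<comment> \<open>Raising the whole cluster of \<open>q\<close> by one after doubling puts
    \<open>q\<close> above \<open>p\<close>, while ranks stay constant on the original clusters and
    strict inequalities survive.\<close>
  define h1 where "h1 w = 2 * h w + (if w \<in> W \<and> \<kappa> w = \<kappa> q then 1 else 0)" for w
  have h1T: "h1 a = h1 b" if "(a, b) \<in> ?T" for a b
  proof -
    have "(a, b) \<in> same_cluster W \<kappa>'" using that by (auto simp: same_cluster_def \<kappa>'_def)
    then show ?thesis using ranked(3) that by (auto simp: h1_def same_cluster_def)
  qed
  have r1: "ranked E ?T U \<psi> h1"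
    unfolding ranked_def
  proof (intro ballI impI)
    fix a b assume ab: "a \<in> U" "b \<in> U" "(a, b) \<in> E" "\<psi> a = \<psi> b" "(a, b) \<notin> ?T"
    \<comment> \<open>No arc joins distinct clusters, so an arc inside the merged cluster already
      lies in an original one.\<close>
    have "(a, b) \<notin> same_cluster W \<kappa>'"
      using W(2)[of a b] ab(3,5) by (auto simp: same_cluster_def adjacent_def)
    then have "h a < h b" using ranked(1) ab unfolding ranked_def by blast
    then show "h1 a < h1 b" by (auto simp: h1_def)
  qed
  have "h p = h q" using ranked(3) pq(1,2) by (auto simp: same_cluster_def \<kappa>'_def)
  then have lt1: "h1 p < h1 q" using pq by (simp add: h1_def)
  let ?U = "U \<union> (Q - {v})"
  obtain \<psi>2 h2 m where r2: "ranked E ?T ?U \<psi>2 h2" "\<psi>2 ` ?U \<subseteq> {..<n}"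
    "\<forall>u\<in>U. \<psi>2 u = \<psi> u \<and> h2 u = m * h1 u" "m > 0"
    using greedy_extension[OF E Q deg r1 ranked(2)] by auto
  have pqU: "p \<in> U" "q \<in> U" using pq W by auto
  have lt2: "h2 p < h2 q" using r2(3,4) pqU lt1 by simp
  let ?A = "{a. (a, v) \<in> E} \<inter> ?U" and ?B = "{b. (v, b) \<in> E} \<inter> ?U"
  have fin: "finite ?A" "finite ?B" using finite_neighbours[OF E(1)] by auto
  have "card ?A \<le> card {a. (a, v) \<in> E}" "card ?B \<le> card {b. (v, b) \<in> E}"
    using finite_neighbours[OF E(1)] by (auto intro: card_mono)
  then have le: "card ?A + card ?B \<le> 2 * n" using deg[OF Q(3)] by linarith
  have "\<exists>c<n. \<forall>a\<in>?A. \<forall>b\<in>?B. \<psi>2 a = c \<longrightarrow> \<psi>2 b = c \<longrightarrow> h2 a < h2 b"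
    using free_colour_or_inj[OF fin le, of \<psi>2]
  proof
    assume "\<exists>c<n. c \<notin> \<psi>2 ` ?A \<or> c \<notin> \<psi>2 ` ?B"
    then obtain c where c: "c < n" "c \<notin> \<psi>2 ` ?A \<or> c \<notin> \<psi>2 ` ?B" by blast
    then have "\<forall>a\<in>?A. \<forall>b\<in>?B. \<psi>2 a = c \<longrightarrow> \<psi>2 b = c \<longrightarrow> h2 a < h2 b"
      by (metis imageI)
    then show ?thesis using c(1) by blast
  next
    assume inj: "inj_on \<psi>2 ?A \<and> inj_on \<psi>2 ?B"
    have eq: "\<psi>2 p = \<psi>2 q" "p \<noteq> q" using r2(3) pqU pq(3,4) by auto
    have "\<not> (p \<in> ?A \<and> q \<in> ?A)" "\<not> (p \<in> ?B \<and> q \<in> ?B)"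
      using inj eq by (auto dest: inj_onD simp del: Int_iff)
    then have pv: "p \<in> ?A" "q \<in> ?B" using pqU pq(5) by blast+
    have "a = p \<and> b = q" if "a \<in> ?A" "b \<in> ?B" "\<psi>2 a = \<psi>2 p" "\<psi>2 b = \<psi>2 p" for a b
      using inj_onD[OF conjunct1[OF inj] that(3,1) pv(1)]
        inj_onD[OF conjunct2[OF inj] that(4)[unfolded eq(1)] that(2) pv(2)] by simp
    then have "\<forall>a\<in>?A. \<forall>b\<in>?B. \<psi>2 a = \<psi>2 p \<longrightarrow> \<psi>2 b = \<psi>2 p \<longrightarrow> h2 a < h2 b"
      using lt2 by metis
    moreover have "\<psi>2 p < n" using r2(2) pqU by auto
    ultimately show ?thesis by blast
  qed
  then obtain c where c: "c < n"
    "\<forall>a\<in>?A. \<forall>b\<in>?B. \<psi>2 a = c \<longrightarrow> \<psi>2 b = c \<longrightarrow> h2 a < h2 b" by blast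
  have finU: "finite ?U" "v \<notin> ?U" using Q by auto
  obtain r where r: "ranked E ?T (insert v ?U) (\<psi>2(v := c)) ((\<lambda>w. 2 * h2 w)(v := r))"
    by (rule ranked_insert[OF r2(1) finU E(2), of c]) (use c(2) in auto)
  have UQ: "insert v ?U = U \<union> Q" using Q(3) by auto
  have vU: "v \<notin> U" using finU by simp
  have "(\<psi>2(v := c)) ` (U \<union> Q) \<subseteq> {..<n}" using r2(2) c(1) unfolding UQ[symmetric] by auto
  moreover have "(\<psi>2(v := c)) a = \<psi> a" if "a \<in> U" for a using that r2(3) vU by auto
  moreover have "((\<lambda>w. 2 * h2 w)(v := r)) a = ((\<lambda>w. 2 * h2 w)(v := r)) b" if ab: "(a, b) \<in> ?T" for a b
  proof -
    have "a \<in> U" "b \<in> U" using ab W(1) by (auto simp: same_cluster_def)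
    then show ?thesis using h1T[OF ab] r2(3) vU by auto
  qed
  ultimately show thesis using r unfolding UQ
    by (intro that[of "\<psi>2(v := c)" "(\<lambda>w. 2 * h2 w)(v := r)"])
qed

text \<open>As \<open>c\<close> is missing on one side of \<open>u\<close> in \<open>W\<close>, the
  monochromatic arcs between \<open>u\<close> and its cluster all enter or all leave
  \<open>u\<close>. A small shift of its rank orders them, so \<open>u\<close> can leave the cluster
  that it had joined.\<close>

lemma detach_cluster_vertex:
  fixes \<kappa> :: "'a \<Rightarrow> 'c" and \<psi> \<phi> :: "'a \<Rightarrow> nat"
  assumes E: "\<And>u. (u, u) \<notin> E" and u: "u \<notin> W"
    and c: "(\<forall>a\<in>W. (a, u) \<in> E \<longrightarrow> \<phi> a \<noteq> c) \<or> (\<forall>b\<in>W. (u, b) \<in> E \<longrightarrow> \<phi> b \<noteq> c)"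
    and ranked: "ranked E (same_cluster (insert u W) (\<kappa>(u := K))) U \<psi> h"
      "\<And>a b. (a, b) \<in> same_cluster (insert u W) (\<kappa>(u := K)) \<Longrightarrow>
         h a = h b \<and> (\<psi> a = \<psi> b \<longleftrightarrow> (\<phi>(u := c)) a = (\<phi>(u := c)) b)"
  shows "\<exists>h'. ranked E (same_cluster W \<kappa>) U \<psi> h' \<and> (\<forall>a b. (a, b) \<in> same_cluster W \<kappa> \<longrightarrow> h' a = h' b)"
proof -
  \<comment> \<open>\<open>u\<close> moves up if it has no out-neighbour of colour \<open>c\<close>
    in \<open>W\<close>; otherwise it has no such in-neighbour and moves down. Doubling leaves room
    for the shift.\<close>
  define d :: int where "d = (if \<forall>b\<in>W. (u, b) \<in> E \<longrightarrow> \<phi> b \<noteq> c then 1 else - 1)"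
  define h' where "h' w = 2 * h w + (if w = u then d else 0)" for w
  have d: "d = 1 \<or> d = - 1" by (simp add: d_def)
  let ?T = "same_cluster W \<kappa>" and ?T' = "same_cluster (insert u W) (\<kappa>(u := K))"
  have sub: "?T \<subseteq> ?T'" using u by (auto simp: same_cluster_def)
  have "ranked E ?T U \<psi> h'"
    unfolding ranked_def
  proof (intro ballI impI)
    fix a b assume ab: "a \<in> U" "b \<in> U" "(a, b) \<in> E" "\<psi> a = \<psi> b" "(a, b) \<notin> ?T"
    show "h' a < h' b"
    proof (cases "(a, b) \<in> ?T'")
      case False
      then have "h a < h b" using ranked(1) ab unfolding ranked_def by blast
      then show ?thesis using d E ab(3) by (auto simp: h'_def)
    next
      case True
      note T' = ranked(2)[OF True]
      consider "a = u" "b \<in> W" | "b = u" "a \<in> W"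
        using True ab(3,5) E u by (auto simp: same_cluster_def split: if_splits)
      then show ?thesis
      proof cases
        case 1
        then have "\<phi> b = c" using T' ab(4) u by (auto split: if_splits)
        then have "d = - 1" using ab(3) 1 by (auto simp: d_def)
        then show ?thesis using T' 1 u by (auto simp: h'_def)
      next
        case 2
        then have "\<phi> a = c" using T' ab(4) u by (auto split: if_splits)
        then have "d = 1" using ab(3) 2 c by (auto simp: d_def)
        then show ?thesis using T' 2 u by (auto simp: h'_def)
      qed
    qed
  qed
  moreover have "h' a = h' b" if "(a, b) \<in> ?T" for a b
    using ranked(2)[of a b] that sub u by (auto simp: h'_def same_cluster_def)
  ultimately show ?thesis by blast
qed

text \<open>Names of the clusters adjacent to \<open>S\<close>; this is the \<open>N\<close> of
  \<open>surplus_choice\<close>.\<close>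

definition touched :: "('a \<times> 'a) set \<Rightarrow> 'a set \<Rightarrow> ('a \<Rightarrow> 'c) \<Rightarrow> 'a set \<Rightarrow> 'c set" where
  "touched E W \<kappa> S = \<kappa> ` {w \<in> W. \<exists>s\<in>S. adjacent E s w}"

text \<open>Induction on the number of vertices in the sets \<open>S i\<close>. Of
  \<open>\<phi>\<close> only the equality of colours within each cluster is kept: cycles inside a
  cluster depend on nothing else, and so colours may be permuted cluster by cluster.\<close>

lemma clustered_extension:
  fixes S :: "'i \<Rightarrow> 'a set" and \<kappa> :: "'a \<Rightarrow> 'c" and \<phi> :: "'a \<Rightarrow> nat"
  assumes E: "finite E" "\<And>u. (u, u) \<notin> E"
    and "finite W" "finite I"
    and "\<And>i. i \<in> I \<Longrightarrow> finite (S i) \<and> S i \<noteq> {} \<and> cut_connected E (S i) \<and> S i \<inter> W = {}"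
    and "\<And>i j. i \<in> I \<Longrightarrow> j \<in> I \<Longrightarrow> i \<noteq> j \<Longrightarrow> S i \<inter> S j = {}"
    and "\<And>a b. a \<in> W \<Longrightarrow> b \<in> W \<Longrightarrow> \<kappa> a \<noteq> \<kappa> b \<Longrightarrow> \<not> adjacent E a b"
    and "\<And>i u. i \<in> I \<Longrightarrow> u \<in> S i \<Longrightarrow> card {a. (a, u) \<in> E} + card {b. (u, b) \<in> E} \<le> 2 * n"
    and "\<phi> ` W \<subseteq> {..<n}"
    and "\<And>A. A \<subseteq> I \<Longrightarrow> A \<noteq> {} \<Longrightarrow> card A < card (\<Union>i\<in>A. touched E W \<kappa> (S i))"
  shows "\<exists>\<psi> h. ranked E (same_cluster W \<kappa>) (W \<union> \<Union> (S ` I)) \<psi> h \<and>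
    \<psi> ` (W \<union> \<Union> (S ` I)) \<subseteq> {..<n} \<and>
    (\<forall>a b. (a, b) \<in> same_cluster W \<kappa> \<longrightarrow> h a = h b \<and> (\<psi> a = \<psi> b \<longleftrightarrow> \<phi> a = \<phi> b))"
  using assms(3-)
proof (induction "card (\<Union> (S ` I))" arbitrary: W I S \<kappa> \<phi> rule: less_induct)
  case less
  note fin = less.prems(1,2) and S = less.prems(3) and disj = less.prems(4)
    and W = less.prems(5) and deg = less.prems(6) and \<phi> = less.prems(7) and surplus = less.prems(8)
  have finV: "finite (\<Union> (S ` I))" using fin S by auto
  have fint: "finite (touched E W \<kappa> (S i))" for i using fin by (simp add: touched_def)
  show ?case
  proof (cases "I = {}")
    case True
    have "ranked E (same_cluster W \<kappa>) W \<phi> (\<lambda>_. 0)"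
      using W by (auto simp: ranked_def same_cluster_def adjacent_def)
    then show ?thesis using True \<phi> by (intro exI[of _ \<phi>] exI[of _ "\<lambda>_. 0"]) auto
  next
    case False
    obtain i where i: "i \<in> I" and loose: "\<And>A C D. A \<subseteq> I - {i} \<Longrightarrow> A \<noteq> {} \<Longrightarrow>
        C \<in> touched E W \<kappa> (S i) \<Longrightarrow> D \<in> touched E W \<kappa> (S i) \<Longrightarrow> C \<noteq> D \<Longrightarrow>
        C \<in> (\<Union>i\<in>A. touched E W \<kappa> (S i)) \<Longrightarrow> D \<in> (\<Union>i\<in>A. touched E W \<kappa> (S i)) \<Longrightarrow>
        Suc (card A) < card (\<Union>i\<in>A. touched E W \<kappa> (S i))"
      by (rule surplus_choice[OF fin(2) fint False surplus]) blast+
    have Si: "finite (S i)" "S i \<noteq> {}" "cut_connected E (S i)" "S i \<inter> W = {}" using S[OF i] by auto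
    show ?thesis
    proof (cases "\<exists>v\<in>S i. \<exists>x\<in>W. \<exists>y\<in>W. adjacent E v x \<and> adjacent E v y \<and> \<kappa> x \<noteq> \<kappa> y")
      case True
      then obtain v x y where vxy: "v \<in> S i" "x \<in> W" "y \<in> W" "adjacent E v x" "adjacent E v y" "\<kappa> x \<noteq> \<kappa> y"
        by blast
      \<comment> \<open>The names are interchanged when \<open>y -> v -> x\<close>, so that a path
        through \<open>v\<close> runs from \<open>p\<close> to \<open>q\<close>, the direction in
        which the ranks will increase.\<close>
      have "\<exists>p\<in>W. \<exists>q\<in>W. \<kappa> p \<noteq> \<kappa> q \<and> adjacent E v p \<and> adjacent E v q \<and>
        ((p, v) \<in> E \<and> (v, q) \<in> E \<or> (p, v) \<in> E \<and> (q, v) \<in> E \<or> (v, p) \<in> E \<and> (v, q) \<in> E)"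
      proof (cases "(y, v) \<in> E \<and> (v, x) \<in> E")
        case True
        then show ?thesis using vxy by (intro bexI[of _ y] bexI[of _ x]) auto
      next
        case False
        then show ?thesis using vxy by (intro bexI[of _ x] bexI[of _ y]) (auto simp: adjacent_def)
      qed
      then obtain p q where pq: "p \<in> W" "q \<in> W" "\<kappa> p \<noteq> \<kappa> q" "adjacent E v p" "adjacent E v q"
        "(p, v) \<in> E \<and> (v, q) \<in> E \<or> (p, v) \<in> E \<and> (q, v) \<in> E \<or> (v, p) \<in> E \<and> (v, q) \<in> E"
        by blast
      \<comment> \<open>\<open>v\<close> meets two clusters: permute the second one so that \<open>p\<close> and \<open>q\<close> get the
        same colour, merge both clusters and set \<open>S i\<close> aside until all others are coloured.\<close>
      define m where "m C = (if C = \<kappa> q then \<kappa> p else C)" for C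
      define \<kappa>' where "\<kappa>' w = (if \<kappa> w = \<kappa> q then \<kappa> p else \<kappa> w)" for w
      define \<phi>' where "\<phi>' w = (if \<kappa> w = \<kappa> q then transpose (\<phi> p) (\<phi> q) (\<phi> w) else \<phi> w)" for w
      have \<kappa>'_m: "\<kappa>' = (\<lambda>w. m (\<kappa> w))" by (auto simp: \<kappa>'_def m_def)
      let ?I = "I - {i}"
      let ?U = "W \<union> \<Union> (S ` ?I)"
      have Un: "\<Union> (S ` I) = S i \<union> \<Union> (S ` ?I)" using i by blast
      have dj: "S i \<inter> \<Union> (S ` ?I) = {}" using disj i by blast
      have "\<Union> (S ` ?I) \<subset> \<Union> (S ` I)" using Un dj Si(2) by blast
      then have "card (\<Union> (S ` ?I)) < card (\<Union> (S ` I))" by (rule psubset_card_mono[OF finV])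
      then have "\<exists>\<psi> h. ranked E (same_cluster W \<kappa>') ?U \<psi> h \<and> \<psi> ` ?U \<subseteq> {..<n} \<and>
        (\<forall>a b. (a, b) \<in> same_cluster W \<kappa>' \<longrightarrow> h a = h b \<and> (\<psi> a = \<psi> b \<longleftrightarrow> \<phi>' a = \<phi>' b))"
      proof (rule less.hyps)
        show "finite W" "finite ?I" using fin by auto
        show "finite (S j) \<and> S j \<noteq> {} \<and> cut_connected E (S j) \<and> S j \<inter> W = {}" if "j \<in> ?I" for j
          using S that by blast
        show "S j \<inter> S k = {}" if "j \<in> ?I" "k \<in> ?I" "j \<noteq> k" for j k using disj that by blast
        show "\<not> adjacent E a b" if "a \<in> W" "b \<in> W" "\<kappa>' a \<noteq> \<kappa>' b" for a b
          using W[OF that(1,2)] that(3) by (metis \<kappa>'_def)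
        show "card {a. (a, u) \<in> E} + card {b. (u, b) \<in> E} \<le> 2 * n" if "j \<in> ?I" "u \<in> S j" for j u
          using deg that by blast
        have "\<phi> p < n" "\<phi> q < n" using pq \<phi> by auto
        then show "\<phi>' ` W \<subseteq> {..<n}" using \<phi> by (auto simp: \<phi>'_def transpose_def)
        fix A assume A: "A \<subseteq> ?I" "A \<noteq> {}"
        let ?N = "\<Union>j\<in>A. touched E W \<kappa> (S j)"
        have finN: "finite ?N" using fint finite_subset[OF _ fin(2), of A] A by auto
        have img: "(\<Union>j\<in>A. touched E W \<kappa>' (S j)) = m ` ?N"
          by (simp only: touched_def \<kappa>'_m image_UN image_image)
        show "card A < card (\<Union>j\<in>A. touched E W \<kappa>' (S j))"
        \<comment> \<open>Merging costs at most one name, and only if both are touched; then the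
          choice of \<open>i\<close> supplies the missing unit.\<close>
        proof (cases "\<kappa> p \<in> ?N \<and> \<kappa> q \<in> ?N")
          case True
          have "Suc (card A) < card ?N"
            by (rule loose[OF A _ _ pq(3)]) (use pq vxy True in \<open>auto simp: touched_def\<close>)
          moreover have "card ?N \<le> Suc (card (m ` ?N))"
          proof -
            have "C \<in> insert (\<kappa> q) (m ` ?N)" if "C \<in> ?N" for C
              using imageI[OF that, of m] by (simp add: m_def split: if_splits)
            then have "?N \<subseteq> insert (\<kappa> q) (m ` ?N)" by (rule subsetI)
            then have "card ?N \<le> card (insert (\<kappa> q) (m ` ?N))" using finN by (intro card_mono) auto
            also have "\<dots> \<le> Suc (card (m ` ?N))" by (rule card_insert_le_m1) auto
            finally show ?thesis .
          qed
          ultimately show ?thesis unfolding img by simp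
        next
          case False
          then have "inj_on m ?N" by (auto simp: inj_on_def m_def)
          then have "card (m ` ?N) = card ?N" by (rule card_image)
          then show ?thesis using surplus[of A] A unfolding img by auto
        qed
      qed
      then obtain \<psi> h where r: "ranked E (same_cluster W \<kappa>') ?U \<psi> h" "\<psi> ` ?U \<subseteq> {..<n}"
        "\<forall>a b. (a, b) \<in> same_cluster W \<kappa>' \<longrightarrow> h a = h b \<and> (\<psi> a = \<psi> b \<longleftrightarrow> \<phi>' a = \<phi>' b)"
        by blast
      have "(p, q) \<in> same_cluster W \<kappa>'" "\<phi>' p = \<phi>' q"
        using pq by (auto simp: same_cluster_def \<kappa>'_def \<phi>'_def)
      then have \<psi>pq: "\<psi> p = \<psi> q" using r(3) by blast
      have finU: "finite ?U" "?U \<inter> S i = {}" "W \<subseteq> ?U" using fin S Si dj by auto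
      obtain \<psi>' h' where r': "ranked E (same_cluster W \<kappa>) (?U \<union> S i) \<psi>' h'"
        "\<psi>' ` (?U \<union> S i) \<subseteq> {..<n}" "\<And>a. a \<in> ?U \<Longrightarrow> \<psi>' a = \<psi> a"
        "\<And>a b. (a, b) \<in> same_cluster W \<kappa> \<Longrightarrow> h' a = h' b"
        by (rule split_merged_cluster[OF E \<kappa>'_def Si(1,3) vxy(1) finU(1,2) deg[OF i] finU(3) W
              r(1) r(2) _ pq(1-3) \<psi>pq pq(6)])
          (use r(3) in \<open>auto simp: \<kappa>'_def\<close>)
      have "\<psi>' a = \<psi>' b \<longleftrightarrow> \<phi> a = \<phi> b" if ab: "(a, b) \<in> same_cluster W \<kappa>" for a b
      proof -
        have abW: "a \<in> W" "b \<in> W" "\<kappa> a = \<kappa> b" using ab by (auto simp: same_cluster_def)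
        then have "(a, b) \<in> same_cluster W \<kappa>'" by (simp add: same_cluster_def \<kappa>'_def)
        moreover have "\<phi>' a = \<phi>' b \<longleftrightarrow> \<phi> a = \<phi> b"
          using abW(3) by (auto simp: \<phi>'_def dest: transpose_eq_imp_eq)
        ultimately show ?thesis using r(3) r'(3) abW by simp
      qed
      moreover have "?U \<union> S i = W \<union> \<Union> (S ` I)" using Un by blast
      ultimately show ?thesis using r' by (intro exI[of _ \<psi>'] exI[of _ h']) auto
    next
      case False
      \<comment> \<open>Each vertex of \<open>S i\<close> meets at most one cluster, so a non-cutvertex \<open>u\<close> can be
        coloured now and join its cluster; the vertices left over meet the same clusters as before.\<close>
      have "S i \<noteq> {v}" for v
      proof
        assume v: "S i = {v}"
        have "touched E W \<kappa> (S i) \<subseteq> {C}" if "C \<in> touched E W \<kappa> (S i)" for C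
          using False that unfolding touched_def v by blast
        then have "card (touched E W \<kappa> (S i)) \<le> 1"
          using card_mono[of "{C}" "touched E W \<kappa> (S i)" for C]
          by (cases "touched E W \<kappa> (S i) = {}") fastforce+
        moreover have "1 < card (touched E W \<kappa> (S i))" using surplus[of "{i}"] i by auto
        ultimately show False by simp
      qed
      then obtain u s where u: "u \<in> S i" "cut_connected E (S i - {u})" "s \<in> S i - {u}" "adjacent E u s"
        using cut_connected_remove_vertex[OF Si(1,3)] Si(2) by blast
      have uW: "u \<notin> W" "s \<notin> W" using u Si by auto
      \<comment> \<open>\<open>K\<close> is the only cluster that \<open>u\<close> meets; if there
        is none, any name is harmless.\<close>
      obtain K where K: "\<And>w. w \<in> W \<Longrightarrow> adjacent E u w \<Longrightarrow> \<kappa> w = K"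
        using False u(1) by metis
      obtain c where c: "c < n"
        "(\<forall>a\<in>W. (a, u) \<in> E \<longrightarrow> \<phi> a \<noteq> c) \<or> (\<forall>b\<in>W. (u, b) \<in> E \<longrightarrow> \<phi> b \<noteq> c)"
        by (rule uncoloured_neighbour_free_colour[OF E(1) deg[OF i u(1)] u(4) uW(2)])
      let ?W = "insert u W" and ?\<kappa> = "\<kappa>(u := K)" and ?\<phi> = "\<phi>(u := c)" and ?S = "S(i := S i - {u})"
      have Un: "\<Union> (S ` I) = insert u (\<Union> (?S ` I))" using i u(1) by (auto split: if_splits)
      have uU: "u \<notin> \<Union> (?S ` I)" using disj i u(1) by (auto split: if_splits)
      have "\<Union> (?S ` I) \<subset> \<Union> (S ` I)"
        unfolding Un using uU by (metis insertI1 psubsetI subset_insertI)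
      then have "card (\<Union> (?S ` I)) < card (\<Union> (S ` I))" by (rule psubset_card_mono[OF finV])
      then have "\<exists>\<psi> h. ranked E (same_cluster ?W ?\<kappa>) (?W \<union> \<Union> (?S ` I)) \<psi> h \<and>
        \<psi> ` (?W \<union> \<Union> (?S ` I)) \<subseteq> {..<n} \<and>
        (\<forall>a b. (a, b) \<in> same_cluster ?W ?\<kappa> \<longrightarrow> h a = h b \<and> (\<psi> a = \<psi> b \<longleftrightarrow> ?\<phi> a = ?\<phi> b))"
      proof (rule less.hyps)
        show "finite ?W" "finite I" using fin by auto
        show "finite (?S j) \<and> ?S j \<noteq> {} \<and> cut_connected E (?S j) \<and> ?S j \<inter> ?W = {}" if "j \<in> I" for j
        proof (cases "j = i")
          case True
          then show ?thesis using Si u by auto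
        next
          case False
          then show ?thesis using S[OF that] disj[OF that i] u(1) by auto
        qed
        show "?S j \<inter> ?S k = {}" if "j \<in> I" "k \<in> I" "j \<noteq> k" for j k
          using disj[OF that] that by auto
        show "\<not> adjacent E a b" if "a \<in> ?W" "b \<in> ?W" "?\<kappa> a \<noteq> ?\<kappa> b" for a b
          using W[of a b] K[of a] K[of b] adjacent_sym[of E a b] that uW by (auto split: if_splits)
        show "card {a. (a, w) \<in> E} + card {b. (w, b) \<in> E} \<le> 2 * n" if "j \<in> I" "w \<in> ?S j" for j w
          using deg[of j w] that by (auto split: if_splits)
        show "?\<phi> ` ?W \<subseteq> {..<n}" using \<phi> c(1) by auto
        fix A assume A: "A \<subseteq> I" "A \<noteq> {}"
        \<comment> \<open>A cluster met through \<open>u\<close> is now met through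
          \<open>s\<close>, because \<open>u\<close> has joined it.\<close>
        have sub: "touched E W \<kappa> (S j) \<subseteq> touched E ?W ?\<kappa> (?S j)" if "j \<in> I" for j
        proof
          fix C assume "C \<in> touched E W \<kappa> (S j)"
          then obtain w t where w: "w \<in> W" "t \<in> S j" "adjacent E t w" "C = \<kappa> w"
            by (auto simp: touched_def)
          show "C \<in> touched E ?W ?\<kappa> (?S j)"
          proof (cases "t = u \<and> j = i")
            case True
            then have "C = ?\<kappa> u" "u \<in> ?W" "s \<in> ?S j" "adjacent E s u"
              using K w u adjacent_sym by auto
            then show ?thesis unfolding touched_def by blast
          next
            case False
            then have "C = ?\<kappa> w" "w \<in> ?W" "t \<in> ?S j" using w uW by auto
            then show ?thesis using w(3) unfolding touched_def by blast
          qed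
        qed
        have finA: "finite A" using A fin finite_subset by blast
        have "card A < card (\<Union>j\<in>A. touched E W \<kappa> (S j))" by (rule surplus[OF A])
        also have "\<dots> \<le> card (\<Union>j\<in>A. touched E ?W ?\<kappa> (?S j))"
        proof (rule card_mono)
          show "finite (\<Union>j\<in>A. touched E ?W ?\<kappa> (?S j))" using finA fin by (simp add: touched_def)
          show "(\<Union>j\<in>A. touched E W \<kappa> (S j)) \<subseteq> (\<Union>j\<in>A. touched E ?W ?\<kappa> (?S j))"
            by (rule UN_mono[OF order_refl sub[OF subsetD[OF A(1)]]])
        qed
        finally show "card A < card (\<Union>j\<in>A. touched E ?W ?\<kappa> (?S j))" .
      qed
      moreover have V: "?W \<union> \<Union> (?S ` I) = W \<union> \<Union> (S ` I)" using Un by (simp only: Un_insert_left Un_insert_right)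
      ultimately have "\<exists>\<psi> h. ranked E (same_cluster ?W ?\<kappa>) (W \<union> \<Union> (S ` I)) \<psi> h \<and>
        \<psi> ` (W \<union> \<Union> (S ` I)) \<subseteq> {..<n} \<and>
        (\<forall>a b. (a, b) \<in> same_cluster ?W ?\<kappa> \<longrightarrow> h a = h b \<and> (\<psi> a = \<psi> b \<longleftrightarrow> ?\<phi> a = ?\<phi> b))"
        by (simp only: V)
      then obtain \<psi> h where r: "ranked E (same_cluster ?W ?\<kappa>) (W \<union> \<Union> (S ` I)) \<psi> h"
        "\<psi> ` (W \<union> \<Union> (S ` I)) \<subseteq> {..<n}"
        "\<forall>a b. (a, b) \<in> same_cluster ?W ?\<kappa> \<longrightarrow> h a = h b \<and> (\<psi> a = \<psi> b \<longleftrightarrow> ?\<phi> a = ?\<phi> b)"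
        by blast
      obtain h' where h': "ranked E (same_cluster W \<kappa>) (W \<union> \<Union> (S ` I)) \<psi> h'"
        "\<forall>a b. (a, b) \<in> same_cluster W \<kappa> \<longrightarrow> h' a = h' b"
        using detach_cluster_vertex[OF E(2) uW(1) c(2) r(1) r(3)[rule_format]] by blast
      have "\<psi> a = \<psi> b \<longleftrightarrow> \<phi> a = \<phi> b" if ab: "(a, b) \<in> same_cluster W \<kappa>" for a b
      proof -
        have "a \<in> W" "b \<in> W" "\<kappa> a = \<kappa> b" using ab by (auto simp: same_cluster_def)
        moreover from this have "a \<noteq> u" "b \<noteq> u" using uW by auto
        ultimately show ?thesis using r(3) by (simp add: same_cluster_def)
      qed
      then show ?thesis using r(2) h' by (intro exI[of _ \<psi>] exI[of _ h']) blast
    qed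
  qed
qed

text \<open>Ranks never decrease along monochromatic arcs. A monochromatic closed walk thus has
  constant rank and uses only arcs of \<open>T\<close>, which are monochromatic for
  \<open>\<phi>\<close> inside \<open>W\<close>.\<close>

lemma acyclic_ranked:
  fixes \<psi> \<phi> :: "'a \<Rightarrow> nat"
  assumes ranked: "ranked E T V \<psi> h"
    and T: "\<And>a b. (a, b) \<in> T \<Longrightarrow> a \<in> W \<and> b \<in> W \<and> h a = h b \<and> (\<psi> a = \<psi> b \<longleftrightarrow> \<phi> a = \<phi> b)"
    and \<phi>: "acyclic {(a, b). (a, b) \<in> E \<and> a \<in> W \<and> b \<in> W \<and> \<phi> a = \<phi> b}"
    and E: "E \<subseteq> V \<times> V"
  shows "acyclic {(a, b). (a, b) \<in> E \<and> \<psi> a = \<psi> b}"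
proof -
  let ?R = "{(a, b). (a, b) \<in> E \<and> \<psi> a = \<psi> b}"
  let ?Q = "{(a, b). (a, b) \<in> E \<and> a \<in> W \<and> b \<in> W \<and> \<phi> a = \<phi> b}"
  have edge: "h a < h b \<or> h a = h b \<and> (a, b) \<in> ?Q" if "(a, b) \<in> ?R" for a b
  proof (cases "(a, b) \<in> T")
    case True
    then show ?thesis using T[OF True] that by simp
  next
    case False
    moreover have "(a, b) \<in> E" "\<psi> a = \<psi> b" "a \<in> V" "b \<in> V" using that E by auto
    ultimately show ?thesis using ranked unfolding ranked_def by blast
  qed
  have "h a < h b \<or> h a = h b \<and> (a, b) \<in> ?Q\<^sup>+" if "(a, b) \<in> ?R\<^sup>+" for a b
    using that
  proof (induction rule: trancl_induct)
    case (base b)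
    then show ?case using edge[OF base] by (meson r_into_trancl)
  next
    case (step b c)
    show ?case using edge[OF step(2)] step(3)
    proof (elim disjE conjE)
      assume "h b = h c" "(b, c) \<in> ?Q" "h a = h b" "(a, b) \<in> ?Q\<^sup>+"
      then show ?thesis by (metis (no_types, lifting) trancl_into_trancl)
    qed auto
  qed
  then show ?thesis using \<phi> unfolding acyclic_def by blast
qed

section \<open>Choice of a minimal family of components\<close>

text \<open>Let \<open>F\<close> be smallest with fewer members than there are clusters outside it.
  By minimality at most \<open>card (F - A)\<close> clusters avoid a proper nonempty subset
  \<open>A\<close>, since these stay clusters when \<open>A\<close> is put back; hence more than
  \<open>card A\<close> meet it. For \<open>A = F\<close>, connectivity of \<open>V\<close> makes
  every cluster meet \<open>A\<close>.\<close>

lemma minimal_surplus_family: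
  assumes fin: "finite V" and V: "cut_connected E V" and X: "X \<subseteq> V" "X \<noteq> {}"
    and lt: "card (conn_parts E X) < card (conn_parts E (V - X))"
  shows "\<exists>F. F \<subseteq> conn_parts E X \<and> F \<noteq> {} \<and> (\<forall>A. A \<subseteq> F \<and> A \<noteq> {} \<longrightarrow>
    card A < card {H \<in> conn_parts E (V - \<Union>F). \<exists>s\<in>\<Union>A. \<exists>w\<in>H. adjacent E s w})"
proof -
  have finX: "finite X" using fin X finite_subset by blast
  let ?P = "\<lambda>F. F \<subseteq> conn_parts E X \<and> F \<noteq> {} \<and> card F < card (conn_parts E (V - \<Union>F))"
  have "\<Union> (conn_parts E X) = X"
  proof
    show "\<Union> (conn_parts E X) \<subseteq> X" by (auto simp: conn_parts_def)
    show "X \<subseteq> \<Union> (conn_parts E X)"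
      using conn_parts_cover[OF finX, where E = E] by (metis UnionI subsetI)
  qed
  then have "?P (conn_parts E X)" using lt X by auto
  then obtain F where F: "?P F" and min: "\<And>F'. ?P F' \<Longrightarrow> card F \<le> card F'"
    using ex_has_least_nat[of ?P "conn_parts E X" card] by blast
  have finF: "finite F" using F finite_conn_parts[OF finX] finite_subset by blast
  let ?W = "V - \<Union>F"
  have fW: "finite (conn_parts E ?W)" using fin by (simp add: finite_conn_parts)
  show ?thesis
  proof (intro exI[of _ F] conjI allI impI)
    show "F \<subseteq> conn_parts E X" "F \<noteq> {}" using F by auto
    fix A assume "A \<subseteq> F \<and> A \<noteq> {}"
    then have A: "A \<subseteq> F" "A \<noteq> {}" by auto
    let ?N = "{H \<in> conn_parts E ?W. \<exists>s\<in>\<Union>A. \<exists>w\<in>H. adjacent E s w}"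
    show "card A < card ?N"
    proof (cases "A = F")
      case True
      have "H \<in> ?N" if H: "H \<in> conn_parts E ?W" for H
      proof -
        have H': "H \<subseteq> ?W" "H \<noteq> {}" "\<And>a b. a \<in> H \<Longrightarrow> b \<in> ?W - H \<Longrightarrow> \<not> adjacent E a b"
          using H by (auto simp: conn_parts_def)
        obtain S where S: "S \<in> F" "S \<noteq> {}" "S \<subseteq> X" using F by (fastforce simp: conn_parts_def)
        then have "H \<noteq> V" using H'(1) X(1) by blast
        then obtain a b where ab: "a \<in> H" "b \<in> V - H" "adjacent E a b"
          using V H' unfolding cut_connected_def by (metis Diff_subset subset_trans)
        then have "b \<in> \<Union>A" using H'(3)[of a b] True by blast
        then show ?thesis using H ab(1) adjacent_sym[OF ab(3)] by blast
      qed
      then have "?N = conn_parts E ?W" by blast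
      then show ?thesis using F True by simp
    next
      case False
      have ne: "F - A \<noteq> {}" using A False by blast
      have finA: "finite A" using A finF finite_subset by blast
      have cA: "card (F - A) = card F - card A" "card A \<le> card F" "0 < card A"
        using A finA finF by (simp_all add: card_Diff_subset card_mono card_gt_0_iff)
      then have "card (F - A) < card F" by linarith
      then have "\<not> ?P (F - A)" using min by (metis not_le)
      then have le: "card (conn_parts E (V - \<Union>(F - A))) \<le> card (F - A)"
        using F ne by (meson Diff_subset not_le subset_trans)
      have "conn_parts E ?W - ?N \<subseteq> conn_parts E (V - \<Union>(F - A))"
      proof
        fix H assume H: "H \<in> conn_parts E ?W - ?N"
        show "H \<in> conn_parts E (V - \<Union>(F - A))"
        proof (rule conn_parts_mono[of H E ?W])
          show "H \<in> conn_parts E ?W" using H by blast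
          show "?W \<subseteq> V - \<Union>(F - A)" by blast
          fix a b assume a: "a \<in> H" and b: "b \<in> V - \<Union>(F - A) - ?W"
          have "b \<in> \<Union>A" using b by blast
          then show "\<not> adjacent E a b" using a H adjacent_sym[of E a b] by blast
        qed
      qed
      then have "card (conn_parts E ?W - ?N) \<le> card (conn_parts E (V - \<Union>(F - A)))"
        by (rule card_mono[rotated]) (use fin in \<open>simp add: finite_conn_parts\<close>)
      moreover have "card (conn_parts E ?W - ?N) = card (conn_parts E ?W) - card ?N"
        by (rule card_Diff_subset) (use fW in auto)
      ultimately show ?thesis using le cA F by linarith
    qed
  qed
qed

section \<open>Transfer to digraphs\<close>

text \<open>A walk across a cut uses a crossing edge; conversely the set reachable from a vertex has
  no edge leaving it within \<open>S\<close>, so it is all of \<open>S\<close>.\<close>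

lemma weakly_connected_induce:
  assumes "wf_digraph G"
  shows "weakly_connected (G \<restriction> S) \<longleftrightarrow> cut_connected (arcs_ends G) S"
proof -
  let ?E = "arcs_ends G" and ?R = "parcs (mk_symmetric (G \<restriction> S))"
  have R: "(a, b) \<in> ?R \<longleftrightarrow> a \<in> S \<and> b \<in> S \<and> adjacent ?E a b" for a b
    by (auto simp: parcs_mk_symmetric adjacent_def arcs_ends_conv image_iff)
  have wc: "weakly_connected (G \<restriction> S) \<longleftrightarrow> (\<forall>u\<in>S. \<forall>v\<in>S. (u, v) \<in> rtrancl_on S ?R)"
    by (auto simp: weakly_connected_def connected_def strongly_connected_def reachable_def)
  show ?thesis
  proof
    assume c: "weakly_connected (G \<restriction> S)"
    show "cut_connected ?E S"
      unfolding cut_connected_def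
    proof (intro allI impI)
      fix A assume A: "A \<subseteq> S \<and> A \<noteq> {} \<and> A \<noteq> S"
      then obtain a b where ab: "a \<in> A" "b \<in> S - A" by blast
      have "(a, b) \<in> rtrancl_on S ?R" using c wc ab A by blast
      then have "b \<in> A \<or> (\<exists>a\<in>A. \<exists>b\<in>S - A. adjacent ?E a b)"
      proof (induction rule: rtrancl_on_induct)
        case (step x y)
        then show ?case using R by blast
      qed (use ab in simp)
      then show "\<exists>a\<in>A. \<exists>b\<in>S - A. adjacent ?E a b" using ab by blast
    qed
  next
    assume c: "cut_connected ?E S"
    have "(u, v) \<in> rtrancl_on S ?R" if u: "u \<in> S" and v: "v \<in> S" for u v
    proof -
      let ?A = "{x \<in> S. (u, x) \<in> rtrancl_on S ?R}"
      have "u \<in> ?A" using u by auto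
      have "?A = S"
      proof (rule ccontr)
        assume "?A \<noteq> S"
        then obtain a b where ab: "a \<in> ?A" "b \<in> S - ?A" "adjacent ?E a b"
          using c \<open>u \<in> ?A\<close> unfolding cut_connected_def
          by (metis (no_types, lifting) empty_iff mem_Collect_eq subsetI)
        then have "(u, b) \<in> rtrancl_on S ?R" using R by (auto intro: rtrancl_on_into_rtrancl_on)
        then show False using ab by blast
      qed
      then show ?thesis using v by blast
    qed
    then show "weakly_connected (G \<restriction> S)" using wc by blast
  qed
qed

lemma induce_induce: "S \<subseteq> Y \<Longrightarrow> (G \<restriction> Y) \<restriction> S = G \<restriction> S"
  by (auto simp: induce_subgraph_def)

text \<open>Adjacent vertices can be added to a connected set, and a larger connected set has an
  edge leaving the smaller one, so maximality means that no edge leaves. For empty \<open>Y\<close>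
  the two sides differ by convention.\<close>

lemma components_induce:
  assumes "wf_digraph G" "Y \<noteq> {}"
  shows "components (G \<restriction> Y) = conn_parts (arcs_ends G) Y"
proof -
  let ?E = "arcs_ends G"
  have wc: "weakly_connected ((G \<restriction> Y) \<restriction> S) \<longleftrightarrow> cut_connected ?E S" if "S \<subseteq> Y" for S
    by (simp only: induce_induce[OF that] weakly_connected_induce[OF assms(1)])
  have comp: "S \<in> components (G \<restriction> Y) \<longleftrightarrow> S \<subseteq> Y \<and> cut_connected ?E S \<and>
      (\<forall>T. S \<subseteq> T \<and> T \<subseteq> Y \<and> cut_connected ?E T \<longrightarrow> T = S)" for S
    unfolding components_def mem_Collect_eq induce_subgraph_verts using wc by (metis (no_types))
  show ?thesis
  proof (intro equalityI subsetI)
    fix S assume "S \<in> components (G \<restriction> Y)"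
    then have S: "S \<subseteq> Y" "cut_connected ?E S"
      and max: "\<And>T. S \<subseteq> T \<Longrightarrow> T \<subseteq> Y \<Longrightarrow> cut_connected ?E T \<Longrightarrow> T = S"
      using comp by auto
    have "S \<noteq> {}"
    proof
      assume "S = {}"
      moreover obtain y where "y \<in> Y" using assms(2) by blast
      ultimately show False using max[of "{y}"] cut_connected_singleton[of ?E y] by auto
    qed
    moreover have "\<not> adjacent ?E a b" if "a \<in> S" "b \<in> Y - S" for a b
    proof
      assume "adjacent ?E a b"
      then have "cut_connected ?E (insert b S)" by (rule cut_connected_insert[OF S(2) that(1)])
      then have "insert b S = S" using max[of "insert b S"] S that by auto
      then show False using that by blast
    qed
    ultimately show "S \<in> conn_parts ?E Y" using S by (auto simp: conn_parts_def)
  next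
    fix S assume "S \<in> conn_parts ?E Y"
    then have S: "S \<subseteq> Y" "cut_connected ?E S" "S \<noteq> {}"
      and no: "\<And>a b. a \<in> S \<Longrightarrow> b \<in> Y - S \<Longrightarrow> \<not> adjacent ?E a b"
      by (auto simp: conn_parts_def)
    have "T = S" if T: "S \<subseteq> T" "T \<subseteq> Y" "cut_connected ?E T" for T
    proof (rule ccontr)
      assume "T \<noteq> S"
      then obtain a b where "a \<in> S" "b \<in> T - S" "adjacent ?E a b"
        using T S(3) unfolding cut_connected_def by metis
      then show False using no T(2) by blast
    qed
    then show "S \<in> components (G \<restriction> Y)" unfolding comp using S by simp
  qed
qed

lemma components_empty: "components (G \<restriction> {}) = {{}}"
  by (auto simp: components_def weakly_connected_def)

lemma acyclic_digraph_iff: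
  assumes "wf_digraph H"
  shows "acyclic_digraph H \<longleftrightarrow> acyclic (arcs_ends H)"
proof -
  interpret wf_digraph H by fact
  have "(\<exists>p. cycle p) \<longleftrightarrow> (\<exists>u. u \<rightarrow>\<^sup>+\<^bsub>H\<^esub> u)"
  proof
    assume "\<exists>p. cycle p"
    then show "\<exists>u. u \<rightarrow>\<^sup>+\<^bsub>H\<^esub> u" by (auto simp: cycle_def reachable1_awalk)
  next
    assume "\<exists>u. u \<rightarrow>\<^sup>+\<^bsub>H\<^esub> u"
    then have "\<exists>p. closed_w p" by (auto simp: closed_w_def reachable1_awalk)
    then show "\<exists>p. cycle p" using closed_w_imp_cycle by blast
  qed
  then show ?thesis by (simp add: acyclic_digraph_def acyclic_def)
qed

text \<open>A closed walk of monochromatic arcs stays in one colour class, so a single acyclic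
  relation replaces the separate classes.\<close>

lemma dicolouring_iff:
  assumes "wf_digraph H"
  shows "dicolouring H n c \<longleftrightarrow>
    c ` verts H \<subseteq> {..<n} \<and> acyclic {(a, b). (a, b) \<in> arcs_ends H \<and> c a = c b}"
proof -
  interpret wf_digraph H by fact
  let ?R = "{(a, b). (a, b) \<in> arcs_ends H \<and> c a = c b}"
  let ?C = "\<lambda>i. H \<restriction> {v \<in> verts H. c v = i}"
  have ends: "arcs_ends (?C i) = {(a, b). (a, b) \<in> arcs_ends H \<and> c a = i \<and> c b = i}" for i
    by (auto simp: arcs_ends_conv image_iff)
  have iff: "acyclic_digraph (?C i) \<longleftrightarrow> acyclic (arcs_ends (?C i))" for i
    by (rule acyclic_digraph_iff) auto
  have "acyclic ?R" if col: "c ` verts H \<subseteq> {..<n}" "\<And>i. i < n \<Longrightarrow> acyclic (arcs_ends (?C i))"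
  proof (rule acyclicI, rule allI, rule notI)
    fix u assume u: "(u, u) \<in> ?R\<^sup>+"
    have "(u, v) \<in> (arcs_ends (?C (c u)))\<^sup>+ \<and> c v = c u" if "(u, v) \<in> ?R\<^sup>+" for v
      using that
    proof (induction rule: trancl_induct)
      case (base v)
      then show ?case unfolding ends by auto
    next
      case (step v w)
      then have "(v, w) \<in> arcs_ends (?C (c u))" unfolding ends by auto
      then show ?case using step by (auto intro: trancl_into_trancl)
    qed
    then have *: "(u, u) \<in> (arcs_ends (?C (c u)))\<^sup>+" using u by blast
    obtain w where "(u, w) \<in> arcs_ends H" using tranclD[OF u] by auto
    then have "c u < n" using col(1) adj_in_verts(1) by blast
    then show False using col(2) * unfolding acyclic_def by blast
  qed
  moreover have "acyclic (arcs_ends (?C i))" if "acyclic ?R" for i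
    by (rule acyclic_subset[OF that]) (auto simp: ends)
  ultimately show ?thesis unfolding dicolouring_def iff by auto
qed

text \<open>An injective colouring shows that the minimum is attained, and a dicolouring with fewer
  than \<open>n\<close> colours is also one with \<open>n\<close>.\<close>

lemma dichromatic_number_le_iff:
  assumes "digraph H"
  shows "dichromatic_number H \<le> n \<longleftrightarrow> (\<exists>c. dicolouring H n c)"
proof
  interpret digraph H by fact
  note iff = dicolouring_iff[OF wf_digraph]
  obtain f :: "'a \<Rightarrow> nat" and m where f: "f ` verts H = {i. i < m}" "inj_on f (verts H)"
    using finite_imp_inj_to_nat_seg[OF finite_verts] by blast
  have e: "{(a, b). (a, b) \<in> arcs_ends H \<and> f a = f b} = {}"
  proof -
    have False if "(a, b) \<in> arcs_ends H" "f a = f b" for a b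
      using inj_onD[OF f(2) that(2)] adj_in_verts[OF that(1)] adj_not_same that(1) by auto
    then show ?thesis by auto
  qed
  have "acyclic {(a, b). (a, b) \<in> arcs_ends H \<and> f a = f b}" unfolding e by (simp add: acyclic_def)
  then have "dicolouring H m f" unfolding iff using f(1) by auto
  then have "\<exists>c. dicolouring H (dichromatic_number H) c"
    unfolding dichromatic_number_def by (intro LeastI_ex[of "\<lambda>n. \<exists>c. dicolouring H n c"]) blast
  moreover assume "dichromatic_number H \<le> n"
  ultimately show "\<exists>c. dicolouring H n c"
    unfolding iff by (meson lessThan_subset_iff subset_trans)
next
  assume "\<exists>c. dicolouring H n c"
  then show "dichromatic_number H \<le> n"
    unfolding dichromatic_number_def by (rule Least_le)
qed

lemma digraph_induce:
  assumes "digraph G" "Y \<subseteq> verts G"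
  shows "digraph (G \<restriction> Y)"
proof -
  interpret digraph G by fact
  have "finite Y" using assms(2) finite_verts finite_subset by blast
  then show ?thesis by unfold_locales (auto intro: no_multi_arcs dest: no_loops)
qed

lemma arcs_ends_degree:
  assumes "digraph G"
  shows "card {a. (a, u) \<in> arcs_ends G} + card {b. (u, b) \<in> arcs_ends G} \<le> total_degree G u"
proof -
  interpret digraph G by fact
  have "{a. (a, u) \<in> arcs_ends G} = tail G ` in_arcs G u" "{b. (u, b) \<in> arcs_ends G} = head G ` out_arcs G u"
    by (auto simp: arcs_ends_conv image_iff)
  then have "card {a. (a, u) \<in> arcs_ends G} \<le> in_degree G u"
    "card {b. (u, b) \<in> arcs_ends G} \<le> out_degree G u"
    by (simp_all add: in_degree_def out_degree_def card_image_le finite_in_arcs finite_out_arcs)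
  then show ?thesis by (simp add: total_degree_def)
qed

text \<open>With the convention for the empty digraph, this excludes that \<open>X\<close> is the
  whole vertex set.\<close>

lemma card_components_ge:
  assumes "wf_digraph G" "finite Y"
  shows "1 \<le> card (components (G \<restriction> Y))"
proof (cases "Y = {}")
  case False
  then obtain y where "y \<in> Y" by blast
  then obtain H where "H \<in> conn_parts (arcs_ends G) Y" using conn_parts_cover[OF assms(2)] by metis
  then have "card (conn_parts (arcs_ends G) Y) \<noteq> 0" using finite_conn_parts[OF assms(2)] by auto
  then show ?thesis using components_induce[OF assms(1) False] by simp
qed (simp add: components_empty)

lemma (in wf_digraph) induce_verts: "G \<restriction> verts G = G"
  by (rule pre_digraph.equality) auto

lemma components_connected:
  assumes "wf_digraph G" "weakly_connected G"
  shows "components (G \<restriction> verts G) = {verts G}"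
proof (cases "verts G = {}")
  case False
  let ?E = "arcs_ends G"
  interpret wf_digraph G by fact
  have "cut_connected ?E (verts G)"
    using weakly_connected_induce[OF assms(1), of "verts G"] assms(2) by (simp add: induce_verts)
  then have V: "verts G \<in> conn_parts ?E (verts G)" using False by (simp add: conn_parts_def)
  have "H = verts G" if H: "H \<in> conn_parts ?E (verts G)" for H
  proof -
    obtain z where "z \<in> H" "z \<in> verts G" using H by (auto simp: conn_parts_def)
    then show ?thesis by (rule conn_parts_inter[OF H V])
  qed
  then show ?thesis using components_induce[OF assms(1) False] V by auto
qed (simp add: components_empty)

theorem theorem6p1:
  fixes G :: "('a, 'b) pre_digraph" and k :: nat and X :: "'a set"
  assumes "digraph G"
    and "weakly_connected G"
    and "k \<ge> 3"
    and "X \<subseteq> verts G"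
    and "\<And>u. u \<in> X \<Longrightarrow> total_degree G u \<le> 2 * (k - 1)"
    and "\<And>S. S \<in> components (G \<restriction> X) \<Longrightarrow> dichromatic_number (delete_verts G S) \<le> k - 1"
    and "card (components (delete_verts G X)) > card (components (G \<restriction> X))"
  shows "dichromatic_number G \<le> k - 1"
proof -
  interpret digraph G by fact
  let ?E = "arcs_ends G" and ?V = "verts G" and ?n = "k - 1"
  have finX: "finite X" using assms(4) finite_verts finite_subset by blast
  have EV: "?E \<subseteq> ?V \<times> ?V" using adj_in_verts by auto
  have E: "finite ?E" "\<And>u. (u, u) \<notin> ?E" using adj_not_same by (auto simp: arcs_ends_def)
  \<comment> \<open>For empty \<open>X\<close> both component counts would be one.\<close>
  have "X \<noteq> {}"
  proof
    assume "X = {}"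
    then show False using assms(7) components_connected[OF wf_digraph assms(2)] by (simp add: components_empty)
  qed
  moreover have "?V - X \<noteq> {}"
  proof
    assume *: "?V - X = {}"
    show False using assms(7) card_components_ge[OF wf_digraph finX] unfolding * components_empty by simp
  qed
  ultimately have comps: "components (G \<restriction> X) = conn_parts ?E X"
    "components (delete_verts G X) = conn_parts ?E (?V - X)"
    using components_induce[OF wf_digraph, of X] components_induce[OF wf_digraph, of "?V - X"] by blast+
  have V: "cut_connected ?E ?V"
    using weakly_connected_induce[OF wf_digraph, of ?V] assms(2) by (simp add: induce_verts)
  obtain F where F: "F \<subseteq> conn_parts ?E X" "F \<noteq> {}"
    and surplus: "\<forall>A. A \<subseteq> F \<and> A \<noteq> {} \<longrightarrow> card A <
      card {H \<in> conn_parts ?E (?V - \<Union>F). \<exists>s\<in>\<Union>A. \<exists>w\<in>H. adjacent ?E s w}"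
    using minimal_surplus_family[OF finite_verts V assms(4) \<open>X \<noteq> {}\<close> assms(7)[unfolded comps]] by blast
  have FX: "S \<subseteq> X" "S \<noteq> {}" "cut_connected ?E S" if "S \<in> F" for S
    using F that by (auto simp: conn_parts_def)
  \<comment> \<open>Besides the vertices outside \<open>X\<close>, \<open>W\<close> contains the
    components of \<open>G[X]\<close> that are not in \<open>F\<close>. Its connected parts are the
    clusters and serve as their own names.\<close>
  define W where "W = ?V - \<Union>F"
  have finW: "finite W" by (simp add: W_def)
  have "\<forall>w\<in>W. \<exists>H. H \<in> conn_parts ?E W \<and> w \<in> H" using conn_parts_cover[OF finW] by metis
  then obtain \<kappa> where \<kappa>: "\<And>w. w \<in> W \<Longrightarrow> \<kappa> w \<in> conn_parts ?E W \<and> w \<in> \<kappa> w" by metis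
  \<comment> \<open>One colouring of \<open>G - S\<close> suffices for the start, because
    \<open>W\<close> avoids all members of \<open>F\<close>.\<close>
  obtain S where S: "S \<in> F" using F(2) by blast
  then have "dichromatic_number (delete_verts G S) \<le> ?n" using assms(6) comps(1) F(1) by blast
  then obtain \<phi> where "dicolouring (delete_verts G S) ?n \<phi>"
    using dichromatic_number_le_iff[OF digraph_induce[OF assms(1)]] by blast
  then have \<phi>: "\<phi> ` (?V - S) \<subseteq> {..<?n}"
    "acyclic {(a, b). (a, b) \<in> arcs_ends (delete_verts G S) \<and> \<phi> a = \<phi> b}"
    by (simp_all add: dicolouring_iff[OF wellformed_induce_subgraph])
  have WS: "W \<subseteq> ?V - S" using S by (auto simp: W_def)
  have \<phi>W: "acyclic {(a, b). (a, b) \<in> ?E \<and> a \<in> W \<and> b \<in> W \<and> \<phi> a = \<phi> b}"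
    by (rule acyclic_subset[OF \<phi>(2)]) (use WS in \<open>auto simp: arcs_ends_conv image_iff\<close>)
  have "\<exists>\<psi> h. ranked ?E (same_cluster W \<kappa>) (W \<union> \<Union> ((\<lambda>S. S) ` F)) \<psi> h \<and>
    \<psi> ` (W \<union> \<Union> ((\<lambda>S. S) ` F)) \<subseteq> {..<?n} \<and>
    (\<forall>a b. (a, b) \<in> same_cluster W \<kappa> \<longrightarrow> h a = h b \<and> (\<psi> a = \<psi> b \<longleftrightarrow> \<phi> a = \<phi> b))"
  proof (rule clustered_extension[OF E finW])
    show "finite F" using F(1) finite_conn_parts[OF finX] finite_subset by blast
    show "finite S \<and> S \<noteq> {} \<and> cut_connected ?E S \<and> S \<inter> W = {}" if "S \<in> F" for S
      using FX[OF that] finX finite_subset that by (auto simp: W_def)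
    show "S \<inter> T = {}" if "S \<in> F" "T \<in> F" "S \<noteq> T" for S T
      using conn_parts_inter[of S ?E X T] F(1) that by blast
    show "\<not> adjacent ?E a b" if "a \<in> W" "b \<in> W" "\<kappa> a \<noteq> \<kappa> b" for a b
    proof -
      have "b \<notin> \<kappa> a" using conn_parts_inter[of "\<kappa> a" ?E W "\<kappa> b" b] \<kappa> that by blast
      then show ?thesis using \<kappa>[OF that(1)] that(2) by (auto simp: conn_parts_def)
    qed
    show "card {a. (a, u) \<in> ?E} + card {b. (u, b) \<in> ?E} \<le> 2 * ?n" if "S \<in> F" "u \<in> S" for S u
      using arcs_ends_degree[OF assms(1), of u] assms(5)[of u] FX(1)[OF that(1)] that(2) by force
    show "\<phi> ` W \<subseteq> {..<?n}" using \<phi>(1) WS by blast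
    fix A assume A: "A \<subseteq> F" "A \<noteq> {}"
    let ?N = "{H \<in> conn_parts ?E W. \<exists>s\<in>\<Union>A. \<exists>w\<in>H. adjacent ?E s w}"
    have "?N \<subseteq> (\<Union>S\<in>A. touched ?E W \<kappa> S)"
    proof
      fix H assume "H \<in> ?N"
      then obtain s S w where *: "H \<in> conn_parts ?E W" "S \<in> A" "s \<in> S" "w \<in> H" "adjacent ?E s w" by blast
      then have "w \<in> W" by (auto simp: conn_parts_def)
      then have "H = \<kappa> w" using \<kappa> conn_parts_inter[OF *(1) _ *(4)] by blast
      then show "H \<in> (\<Union>S\<in>A. touched ?E W \<kappa> S)" using * \<open>w \<in> W\<close> by (auto simp: touched_def)
    qed
    moreover have "finite A" using A(1) \<open>finite F\<close> finite_subset by blast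
    then have "finite (\<Union>S\<in>A. touched ?E W \<kappa> S)" using finW by (simp add: touched_def)
    ultimately show "card A < card (\<Union>S\<in>A. touched ?E W \<kappa> S)"
      using surplus A unfolding W_def[symmetric] by (meson card_mono less_le_trans)
  qed
  moreover have WF: "W \<union> \<Union> ((\<lambda>S. S) ` F) = ?V" using FX(1) assms(4) by (auto simp: W_def)
  ultimately obtain \<psi> h where r: "ranked ?E (same_cluster W \<kappa>) ?V \<psi> h" "\<psi> ` ?V \<subseteq> {..<?n}"
    "\<forall>a b. (a, b) \<in> same_cluster W \<kappa> \<longrightarrow> h a = h b \<and> (\<psi> a = \<psi> b \<longleftrightarrow> \<phi> a = \<phi> b)"
    unfolding WF by blast
  have "acyclic {(a, b). (a, b) \<in> ?E \<and> \<psi> a = \<psi> b}"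
    by (rule acyclic_ranked[OF r(1) _ \<phi>W EV]) (use r(3) in \<open>auto simp: same_cluster_def\<close>)
  then have "dicolouring G ?n \<psi>" unfolding dicolouring_iff[OF wf_digraph] using r(2) by simp
  then show ?thesis using dichromatic_number_le_iff[OF assms(1)] by blast
qed

end
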